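(* Every $\omega$-category is equivalent to one that is free on a computad. Precisely: for every $\omega$-category $X$, the counit $r_X:QX=K^wWX\to X$ of the adjunction $K^w\zeta\dashv W$ has the right lifting property with respect to all the inclusions $K^w\iota_n:K^w\mathbb S^{n-1}\to K^w\mathbb D^n$, $n\in\mathbb N$; that is, $r_X$ is a local $\omega$-surjection.
   Context: **Globular sets and Batanin trees.** A globular set $X$ consists of sets $X_n$ ($n\in\mathbb N$) and maps $\mathrm{src},\mathrm{tgt}:X_{n+1}\to X_n$ with $\mathrm{src}\,\mathrm{src}=\mathrm{src}\,\mathrm{tgt}$, $\mathrm{tgt}\,\mathrm{src}=\mathrm{tgt}\,\mathrm{tgt}$; $\mathsf{Glob}$ is their category. The set of Batanin trees is inductively generated by: for every finite (possibly empty) list $[B_1,\dots,B_m]$ of trees, a tree $\mathrm{br}[B_1,\dots,B_m]$. $\dim\mathrm{br}[\,]=0$ and otherwise $\dim\mathrm{br}[B_1,\dots,B_m]=1+\max_i\dim B_i$. The globular set $\mathrm{Pos}(B)$ of positions is inductively generated by: $\mathrm{init}\in\mathrm{Pos}_0(B)$ for every $B$; $\mathrm{inr}(p)\in\mathrm{Pos}_n(\mathrm{br}[B,B_1,\dots,B_m])$ for $p\in\mathrm{Pos}_n(\mathrm{br}[B_1,\dots,B_m])$; $\mathrm{inl}(q)\in\mathrm{Pos}_{n+1}(\mathrm{br}[B,B_1,\dots,B_m])$ for $q\in\mathrm{Pos}_n(B)$. Source and target: $\mathrm{src}(\mathrm{inr}\,p)=\mathrm{inr}(\mathrm{src}\,p)$,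 $\mathrm{tgt}(\mathrm{inr}\,p)=\mathrm{inr}(\mathrm{tgt}\,p)$; if $q$ has dimension $0$, $\mathrm{src}(\mathrm{inl}\,q)=\mathrm{init}$ and $\mathrm{tgt}(\mathrm{inl}\,q)=\mathrm{inr}(\mathrm{init})$; otherwise $\mathrm{src}(\mathrm{inl}\,q)=\mathrm{inl}(\mathrm{src}\,q)$, $\mathrm{tgt}(\mathrm{inl}\,q)=\mathrm{inl}(\mathrm{tgt}\,q)$. We write $B$ for $\mathrm{Pos}(B)$. A position $p\in\mathrm{Pos}_n(B)$ is source (resp. target) boundary if it is not the target (resp. source) of any $(n+1)$-position; $\partial^s_n(B)$, $\partial^t_n(B)$ are the sets of source, target boundary $n$-positions. Globes: $D_0=\mathrm{br}[\,]$, $D_{n+1}=\mathrm{br}[D_n]$. **Computads.** By induction on $n$ one defines categories $\mathsf{Comp}_n$, functors $u_n:\mathsf{Comp}_n\to\mathsf{Comp}_{n-1}$ and $\mathrm{Cell}_n,\mathrm{Sphere}_n:\mathsf{Comp}_n\to\mathsf{Set}$, a natural transformation $\mathrm{bdry}_n:\mathrm{Cell}_n\Rightarrow\mathrm{Sphere}_{n-1}u_n$, and, for globular sets $X$, computads $\mathrm{Free}_nX$ and spheres $\mathrm{ps}_{n,X}(a,b)\in\mathrm{Sphere}_n(\mathrm{Free}_nX)$ for $a,b\in X_n$ with common source and target. $\mathsf{Comp}_{-1}$ is the terminal category and $\mathrm{Sphere}_{-1}$ is a singleton. *$n=0$:* $\mathsf{Comp}_0=\mathsf{Set}$, $\mathrm{Cell}_0=\mathrm{id}$,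 $\mathrm{Sphere}_0(C)=C\times C$, $\mathrm{Free}_0X=X_0$, $\mathrm{ps}_{0,X}(a,b)=(a,b)$, $\mathrm{supp}(c)=\{c\}$; a $0$-sphere $(a,b)$ of $\mathrm{Free}_0B$ is full iff $a$ is source boundary and $b$ is target boundary. *$n>0$:* an $n$-computad is $C=(C_{n-1},V_n^C,\phi_n^C)$ with $C_{n-1}\in\mathsf{Comp}_{n-1}$, a set $V_n^C$ of generators and $\phi_n^C:V_n^C\to\mathrm{Sphere}_{n-1}(C_{n-1})$. $\mathrm{Free}_nX=(\mathrm{Free}_{n-1}X,X_n,x\mapsto\mathrm{ps}_{n-1,X}(\mathrm{src}\,x,\mathrm{tgt}\,x))$. Mutually inductively: a homomorphism $\sigma:D\to C$ is a pair of $\sigma_{n-1}:D_{n-1}\to C_{n-1}$ and $\sigma_V:V_n^D\to\mathrm{Cell}_n(C)$ with $\mathrm{bdry}_n\sigma_V=\mathrm{Sphere}_{n-1}(\sigma_{n-1})\phi_n^D$; $\mathrm{Cell}_n(C)$ is generated by $\mathrm{var}\,v$ for $v\in V_n^C$ and $\mathrm{coh}(B,A,\tau)$ for $B$ a Batanin tree with $\dim B\le n$, $A$ a full sphere in $\mathrm{Sphere}_{n-1}(\mathrm{Free}_{n-1}B)$ and $\tau:\mathrm{Free}_nB\to C$ a homomorphism; $\mathrm{bdry}_n(\mathrm{var}\,v)=\phi_n^C(v)$, $\mathrm{bdry}_n(\mathrm{coh}(B,A,\tau))=\mathrm{Sphere}_{n-1}(\tau_{n-1})(A)$. Action and composition: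 $\mathrm{Cell}_n(\sigma)(\mathrm{var}\,v)=\sigma_V(v)$, $\mathrm{Cell}_n(\sigma)(\mathrm{coh}(B,A,\tau))=\mathrm{coh}(B,A,\sigma\circ\tau)$, $\sigma\circ\tau=(\sigma_{n-1}\circ\tau_{n-1},\mathrm{Cell}_n(\sigma)\circ\tau_V)$. $\mathrm{Sphere}_n(C)$ is the set of triples $(A,a,b)$ with $a,b\in\mathrm{Cell}_n(C)$, $\mathrm{bdry}_n a=\mathrm{bdry}_n b=A$; $\mathrm{pr}_1,\mathrm{pr}_2$ pick $a,b$. $\mathrm{ps}_{n,X}(p,q)=(\mathrm{ps}_{n-1,X}(\mathrm{src}\,p,\mathrm{tgt}\,p),\mathrm{var}\,p,\mathrm{var}\,q)$. $\mathrm{supp}(\mathrm{var}\,v)=\{v\}$, $\mathrm{supp}(\mathrm{coh}(B,A,\tau))=\bigcup_{p\in\mathrm{Pos}_n(B)}\mathrm{supp}(\tau_V(p))$. $(A,a,b)\in\mathrm{Sphere}_n(\mathrm{Free}_nB)$ is full iff $A$ is full, $\mathrm{supp}(a)=\partial_n^s(B)$ and $\mathrm{supp}(b)=\partial_n^t(B)$. $\mathsf{Comp}$ is the limit of the $u_n$; its objects $C=(C_n)_n$ are computads. $V_0^C=C_0$ and for $0$-cells $\mathrm{var}\,x$ means $x$. **$\omega$-categories.** $\mathrm{Free}:\mathsf{Glob}\to\mathsf{Comp}$ sends $X$ to $(\mathrm{Free}_nX)_n$ and $f$ to the homomorphism $x\mapsto\mathrm{var}\,f(x)$. $\mathrm{Cell}:\mathsf{Comp}\to\mathsf{Glob}$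 sends $C$ to the globular set of its cells, with $\mathrm{src}=\mathrm{pr}_1\mathrm{bdry}$, $\mathrm{tgt}=\mathrm{pr}_2\mathrm{bdry}$. $\mathrm{Free}\dashv\mathrm{Cell}$, inducing a monad $\mathrm{fc}^w=\mathrm{Cell}\circ\mathrm{Free}$ on $\mathsf{Glob}$; $\omega\mathsf{Cat}$ is its category of algebras, and $K^w:\mathsf{Comp}\to\omega\mathsf{Cat}$ the comparison functor ($K^wC$ is the free $\omega$-category on $C$). $\mathsf{Comp}^{\mathrm{var}}\subseteq\mathsf{Comp}$ is the wide subcategory of generator-preserving homomorphisms (those sending every generator to a cell $\mathrm{var}\,w$, $w$ a generator), $\zeta$ its inclusion. **Disks and spheres.** $\mathbb D^n=\mathrm{Free}\,D_n$. $\mathbb S^n=\mathrm{Free}\,S_n$ ($n\ge-1$), where $S_n$ is the globular set with exactly two $k$-cells $e_k^-,e_k^+$ for each $0\le k\le n$, none above, with $\mathrm{src}\,e_{k+1}^\pm=e_k^-$, $\mathrm{tgt}\,e_{k+1}^\pm=e_k^+$. $\iota_n:\mathbb S^{n-1}\to\mathbb D^n$ is $\mathrm{Free}$ of the map sending $e_k^-,e_k^+$ to the iterated $k$-dimensional source, target of the top position of $D_n$. **$W$ and $r$.** $W:\omega\mathsf{Cat}\to\mathsf{Comp}^{\mathrm{var}}$ is the right adjoint of $K^w\zeta$. Explicitly, $WX=(W_nX)_n$, with $W_0X=X_0$, $W_{n+1}X=(W_nX,V_{n+1}^{WX},(A,x)\mapsto A)$, $V^{WX}_{n+1}$ being the set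 of pairs $(A,x)$ with $A\in\mathrm{Sphere}_n(W_nX)$, $x\in X_{n+1}$, $\mathrm{src}\,x=r_X(\mathrm{pr}_1A)$, $\mathrm{tgt}\,x=r_X(\mathrm{pr}_2A)$; $r_X$ is the homomorphism out of the free $\omega$-category, extended dimension by dimension by $r_X(\mathrm{var}(A,x))=x$ and identity on $0$-cells. **Local $\omega$-surjection.** A homomorphism $f:Y\to X$ that is surjective on $0$-cells and such that for every pair of $n$-cells $a,b$ of $Y$ with the same source and target ($n\ge0$, no condition if $n=0$) and every $(n+1)$-cell $x:f(a)\to f(b)$ of $X$ there is an $(n+1)$-cell $y:a\to b$ of $Y$ with $f(y)=x$. This is the notion of equivalence (local $\omega$-equivalence) used in the first sentence of the claim. *)

theory Defs
  imports Main
begin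

section \<open>Globular sets and Batanin trees\<close>

text \<open>A family \<open>f :: nat \<Rightarrow> 'a \<Rightarrow> 'b\<close> stands for maps \<open>f n\<close>, one in each dimension, and only its
  values on the relevant sets matter.  \<open>gsrc X n\<close> and \<open>gtgt X n\<close> go from \<open>(n+1)\<close>-cells
  to \<open>n\<close>-cells.\<close>

record 'a glob =
  gcells :: "nat \<Rightarrow> 'a set"
  gsrc :: "nat \<Rightarrow> 'a \<Rightarrow> 'a"
  gtgt :: "nat \<Rightarrow> 'a \<Rightarrow> 'a"

definition globular_set :: "('a, 'm) glob_scheme \<Rightarrow> bool" where
  "globular_set X \<longleftrightarrow>
     (\<forall>n. \<forall>x\<in>gcells X (Suc n). gsrc X n x \<in> gcells X n \<and> gtgt X n x \<in> gcells X n) \<and>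
     (\<forall>n. \<forall>x\<in>gcells X (Suc (Suc n)).
        gsrc X n (gsrc X (Suc n) x) = gsrc X n (gtgt X (Suc n) x) \<and>
        gtgt X n (gsrc X (Suc n) x) = gtgt X n (gtgt X (Suc n) x))"

definition glob_map :: "('a, 'm) glob_scheme \<Rightarrow> ('b, 'l) glob_scheme \<Rightarrow> (nat \<Rightarrow> 'a \<Rightarrow> 'b) \<Rightarrow> bool" where
  "glob_map X Y f \<longleftrightarrow>
     (\<forall>n. \<forall>x\<in>gcells X n. f n x \<in> gcells Y n) \<and>
     (\<forall>n. \<forall>x\<in>gcells X (Suc n).
        f n (gsrc X n x) = gsrc Y n (f (Suc n) x) \<and>
        f n (gtgt X n x) = gtgt Y n (f (Suc n) x))"

datatype tree = Br "tree list"

primrec tree_dim :: "tree \<Rightarrow> nat" where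
  "tree_dim (Br Bs) = (if Bs = [] then 0 else Suc (Max (set (map tree_dim Bs))))"

datatype pos = PInit | PInr pos | PInl pos

inductive is_pos :: "nat \<Rightarrow> tree \<Rightarrow> pos \<Rightarrow> bool" where
  init: "is_pos 0 B PInit"
| inr: "is_pos n (Br Bs) p \<Longrightarrow> is_pos n (Br (B # Bs)) (PInr p)"
| inl: "is_pos n B q \<Longrightarrow> is_pos (Suc n) (Br (B # Bs)) (PInl q)"

text \<open>As for \<open>gsrc\<close>, the index is the dimension of the result; the values at \<open>PInit\<close> are junk.\<close>

primrec pos_src :: "pos \<Rightarrow> nat \<Rightarrow> pos" where
  "pos_src PInit n = PInit"
| "pos_src (PInr p) n = PInr (pos_src p n)"
| "pos_src (PInl q) n = (case n of 0 \<Rightarrow> PInit | Suc m \<Rightarrow> PInl (pos_src q m))"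

primrec pos_tgt :: "pos \<Rightarrow> nat \<Rightarrow> pos" where
  "pos_tgt PInit n = PInit"
| "pos_tgt (PInr p) n = PInr (pos_tgt p n)"
| "pos_tgt (PInl q) n = (case n of 0 \<Rightarrow> PInr PInit | Suc m \<Rightarrow> PInl (pos_tgt q m))"

definition Pos :: "tree \<Rightarrow> pos glob" where
  "Pos B = \<lparr>gcells = (\<lambda>n. {p. is_pos n B p}),
            gsrc = (\<lambda>n p. pos_src p n), gtgt = (\<lambda>n p. pos_tgt p n)\<rparr>"

definition src_boundary :: "nat \<Rightarrow> tree \<Rightarrow> pos set" where
  "src_boundary n B =
     {p \<in> gcells (Pos B) n. \<not> (\<exists>q\<in>gcells (Pos B) (Suc n). gtgt (Pos B) n q = p)}"

definition tgt_boundary :: "nat \<Rightarrow> tree \<Rightarrow> pos set" where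
  "tgt_boundary n B =
     {p \<in> gcells (Pos B) n. \<not> (\<exists>q\<in>gcells (Pos B) (Suc n). gsrc (Pos B) n q = p)}"


section \<open>Raw cells and spheres\<close>

text \<open>\<open>NoSph\<close> is the unique \<open>(-1)\<close>-sphere, so that a \<open>0\<close>-sphere \<open>(a, b)\<close> is \<open>Sph NoSph a b\<close>.
  An \<open>(n-1)\<close>-sphere has \<open>sph_len\<close> equal to \<open>n\<close>; all families of spheres below are indexed by
  this shifted number \<open>n\<close>.\<close>

datatype 'c sphere = NoSph | Sph "'c sphere" (pr1: 'c) (pr2: 'c)

primrec sph_len :: "'c sphere \<Rightarrow> nat" where
  "sph_len NoSph = 0"
| "sph_len (Sph A a b) = Suc (sph_len A)"

text \<open>\<open>Var n v\<close> is the cell on an \<open>n\<close>-dimensional generator \<open>v\<close>; generator sets of different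
  dimensions need not be disjoint.  \<open>Coh B A \<tau>\<close> has dimension \<open>sph_len A\<close>.  Its sphere consists
  of cells over the positions of \<open>B\<close>, a non-uniform recursion over the type of generators.  It
  is obtained in two steps: the type \<open>'s\<close> of the cells occurring in spheres is first left open,
  and the knot is tied by \<open>pcell\<close>, an isomorphic copy of \<open>pos cell\<close>.\<close>

datatype ('s, 'v) gcell =
  Var nat 'v
| Coh tree "'s sphere" "nat \<Rightarrow> pos \<Rightarrow> ('s, 'v) gcell"

datatype pcell = PCell (of_pcell: "(pcell, pos) gcell")

type_synonym 'v cell = "(pcell, 'v) gcell"

text \<open>Homomorphisms out of \<open>Free\<^sub>n B\<close> that are stored inside cells are made unique by a
  default value outside the positions of dimension at most \<open>n\<close>.\<close>

definition pos_cut :: "nat \<Rightarrow> tree \<Rightarrow> (nat \<Rightarrow> pos \<Rightarrow> 'c) \<Rightarrow> nat \<Rightarrow> pos \<Rightarrow> 'c" where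
  "pos_cut n B \<tau> = (\<lambda>k p. if k \<le> n \<and> p \<in> gcells (Pos B) k then \<tau> k p else undefined)"

text \<open>\<open>subst \<sigma>\<close> is \<open>Cell(\<sigma>)\<close>, and \<open>map_sphere (subst \<sigma>)\<close> is \<open>Sphere(\<sigma>)\<close>.\<close>

primrec subst :: "(nat \<Rightarrow> 'v \<Rightarrow> ('s, 'w) gcell) \<Rightarrow> ('s, 'v) gcell \<Rightarrow> ('s, 'w) gcell" where
  "subst \<sigma> (Var n v) = \<sigma> n v"
| "subst \<sigma> (Coh B A \<tau>) = Coh B A (pos_cut (sph_len A) B (\<lambda>k p. subst \<sigma> (\<tau> k p)))"

primrec supp :: "('s, 'v) gcell \<Rightarrow> 'v set" where
  "supp (Var n v) = {v}"
| "supp (Coh B A \<tau>) = (\<Union>p\<in>gcells (Pos B) (sph_len A). supp (\<tau> (sph_len A) p))"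


section \<open>Computads\<close>

text \<open>A computad is given by its generators and attaching spheres in all dimensions; the
  truncation \<open>C\<^sub>n\<close> consists of the data in dimensions up to \<open>n\<close>, and the \<open>n\<close>-cells depend on
  nothing else.  In dimension \<open>0\<close> the attaching sphere is \<open>NoSph\<close>.\<close>

record 'v computad =
  gens :: "nat \<Rightarrow> 'v set"
  attach :: "nat \<Rightarrow> 'v \<Rightarrow> 'v cell sphere"

primrec bdry :: "'v computad \<Rightarrow> 'v cell \<Rightarrow> 'v cell sphere" where
  "bdry C (Var n v) = attach C n v"
| "bdry C (Coh B A \<tau>) = map_sphere (subst \<tau>) (map_sphere of_pcell A)"

primrec pos_sphere :: "('a, 'm) glob_scheme \<Rightarrow> nat \<Rightarrow> 'a \<Rightarrow> 'a \<Rightarrow> 'a cell sphere" where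
  "pos_sphere X 0 x y = Sph NoSph (Var 0 x) (Var 0 y)"
| "pos_sphere X (Suc n) x y =
     Sph (pos_sphere X n (gsrc X n x) (gtgt X n x)) (Var (Suc n) x) (Var (Suc n) y)"

definition Free :: "('a, 'm) glob_scheme \<Rightarrow> 'a computad" where
  "Free X = \<lparr>gens = gcells X,
     attach = (\<lambda>n x. case n of 0 \<Rightarrow> NoSph | Suc m \<Rightarrow> pos_sphere X m (gsrc X m x) (gtgt X m x))\<rparr>"

text \<open>The predicate \<open>F\<close> is a placeholder for fullness of spheres, which itself refers to
  cells of the computads \<open>Free (Pos B)\<close>.\<close>

inductive gen_cell ::
  "(tree \<Rightarrow> pos cell sphere \<Rightarrow> bool) \<Rightarrow> 'v computad \<Rightarrow> nat \<Rightarrow> 'v cell \<Rightarrow> bool"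
  for F C where
  var: "v \<in> gens C n \<Longrightarrow> gen_cell F C n (Var n v)"
| coh: "\<lbrakk>sph_len A = n; F B A; tree_dim B \<le> n;
      \<forall>k p. k \<le> n \<longrightarrow> p \<in> gcells (Pos B) k \<longrightarrow>
        gen_cell F C k (\<tau> k p) \<and>
        bdry C (\<tau> k p) = map_sphere (subst \<tau>) (attach (Free (Pos B)) k p);
      pos_cut n B \<tau> = \<tau>\<rbrakk>
    \<Longrightarrow> gen_cell F C n (Coh B (map_sphere PCell A) \<tau>)"

lemma gen_cell_mono [mono]:
  assumes "\<And>B A. F B A \<longrightarrow> G B A"
  shows "gen_cell F C n c \<longrightarrow> gen_cell G C n c"
proof
  assume "gen_cell F C n c"
  then show "gen_cell G C n c"
    by induction (use assms in \<open>auto intro!: gen_cell.intros\<close>)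
qed

text \<open>There is no full \<open>(-1)\<close>-sphere, so that coherence cells have positive dimension.\<close>

inductive full :: "tree \<Rightarrow> pos cell sphere \<Rightarrow> bool" where
  full_0: "\<lbrakk>p \<in> src_boundary 0 B; q \<in> tgt_boundary 0 B\<rbrakk>
    \<Longrightarrow> full B (Sph NoSph (Var 0 p) (Var 0 q))"
| full_Suc: "\<lbrakk>full B A; sph_len A = n;
      gen_cell full (Free (Pos B)) n a; gen_cell full (Free (Pos B)) n b;
      bdry (Free (Pos B)) a = A; bdry (Free (Pos B)) b = A;
      supp a = src_boundary n B; supp b = tgt_boundary n B\<rbrakk>
    \<Longrightarrow> full B (Sph A a b)"

definition cells :: "'v computad \<Rightarrow> nat \<Rightarrow> 'v cell set" where
  "cells C n = {c. gen_cell full C n c}"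

text \<open>\<open>spheres C n\<close> is \<open>Sphere\<^bsub>n-1\<^esub>(C)\<close>.\<close>

primrec spheres :: "'v computad \<Rightarrow> nat \<Rightarrow> 'v cell sphere set" where
  "spheres C 0 = {NoSph}"
| "spheres C (Suc n) = {Sph A a b | A a b.
     A \<in> spheres C n \<and> a \<in> cells C n \<and> b \<in> cells C n \<and> bdry C a = A \<and> bdry C b = A}"

definition is_computad :: "'v computad \<Rightarrow> bool" where
  "is_computad C \<longleftrightarrow> (\<forall>n. \<forall>v\<in>gens C n. attach C n v \<in> spheres C n)"

definition Cell :: "'v computad \<Rightarrow> 'v cell glob" where
  "Cell C = \<lparr>gcells = cells C,
     gsrc = (\<lambda>n c. pr1 (bdry C c)), gtgt = (\<lambda>n c. pr2 (bdry C c))\<rparr>"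

definition Free_map :: "(nat \<Rightarrow> 'a \<Rightarrow> 'b) \<Rightarrow> nat \<Rightarrow> 'a \<Rightarrow> 'b cell" where
  "Free_map f = (\<lambda>n x. Var n (f n x))"

definition Cell_map :: "(nat \<Rightarrow> 'v \<Rightarrow> 'w cell) \<Rightarrow> nat \<Rightarrow> 'v cell \<Rightarrow> 'w cell" where
  "Cell_map \<sigma> = (\<lambda>n c. subst \<sigma> c)"


section \<open>\<open>\<omega>\<close>-categories\<close>

text \<open>The counit \<open>Free (Cell C) \<rightarrow> C\<close> sends the generator \<open>c\<close> to the cell \<open>c\<close>, and the unit
  \<open>X \<rightarrow> Cell (Free X)\<close> is \<open>Var\<close>.\<close>

definition counit :: "nat \<Rightarrow> 'v cell \<Rightarrow> 'v cell" where
  "counit = (\<lambda>n c. c)"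

definition fc :: "('a, 'm) glob_scheme \<Rightarrow> 'a cell glob" where
  "fc X = Cell (Free X)"

definition fc_map :: "(nat \<Rightarrow> 'a \<Rightarrow> 'b) \<Rightarrow> nat \<Rightarrow> 'a cell \<Rightarrow> 'b cell" where
  "fc_map f = Cell_map (Free_map f)"

definition fc_mult :: "nat \<Rightarrow> 'a cell cell \<Rightarrow> 'a cell" where
  "fc_mult = Cell_map counit"

record 'a omega_cat = "'a glob" +
  act :: "nat \<Rightarrow> 'a cell \<Rightarrow> 'a"

definition is_omega_cat :: "'a omega_cat \<Rightarrow> bool" where
  "is_omega_cat X \<longleftrightarrow>
     globular_set X \<and> glob_map (fc X) X (act X) \<and>
     (\<forall>n. \<forall>x\<in>gcells X n. act X n (Var n x) = x) \<and>
     (\<forall>n. \<forall>c\<in>gcells (fc (fc X)) n. act X n (fc_mult n c) = act X n (fc_map (act X) n c))"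

definition omega_hom :: "'a omega_cat \<Rightarrow> 'b omega_cat \<Rightarrow> (nat \<Rightarrow> 'a \<Rightarrow> 'b) \<Rightarrow> bool" where
  "omega_hom Y X f \<longleftrightarrow>
     glob_map Y X f \<and>
     (\<forall>n. \<forall>c\<in>gcells (fc Y) n. f n (act Y n c) = act X n (fc_map f n c))"

text \<open>The comparison functor \<open>K\<^sup>w\<close>, on objects; on a homomorphism \<open>\<sigma>\<close> it is \<open>Cell_map \<sigma>\<close>.\<close>

definition Kw :: "'v computad \<Rightarrow> 'v cell omega_cat" where
  "Kw C = \<lparr>gcells = gcells (Cell C), gsrc = gsrc (Cell C), gtgt = gtgt (Cell C),
           act = Cell_map counit\<rparr>"

definition has_rlp ::
  "'y omega_cat \<Rightarrow> 'x omega_cat \<Rightarrow> (nat \<Rightarrow> 'y \<Rightarrow> 'x) \<Rightarrow>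
   'a omega_cat \<Rightarrow> 'b omega_cat \<Rightarrow> (nat \<Rightarrow> 'a \<Rightarrow> 'b) \<Rightarrow> bool" where
  "has_rlp Y X f A B i \<longleftrightarrow>
     (\<forall>u v. omega_hom A Y u \<longrightarrow> omega_hom B X v \<longrightarrow>
        (\<forall>n. \<forall>a\<in>gcells A n. f n (u n a) = v n (i n a)) \<longrightarrow>
        (\<exists>l. omega_hom B Y l \<and>
           (\<forall>n. \<forall>a\<in>gcells A n. l n (i n a) = u n a) \<and>
           (\<forall>n. \<forall>b\<in>gcells B n. f n (l n b) = v n b)))"

definition local_omega_surjection ::
  "'y omega_cat \<Rightarrow> 'x omega_cat \<Rightarrow> (nat \<Rightarrow> 'y \<Rightarrow> 'x) \<Rightarrow> bool" where
  "local_omega_surjection Y X f \<longleftrightarrow>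
     (\<forall>x\<in>gcells X 0. \<exists>y\<in>gcells Y 0. f 0 y = x) \<and>
     (\<forall>n. \<forall>a\<in>gcells Y n. \<forall>b\<in>gcells Y n.
        (\<forall>m. n = Suc m \<longrightarrow> gsrc Y m a = gsrc Y m b \<and> gtgt Y m a = gtgt Y m b) \<longrightarrow>
        (\<forall>x\<in>gcells X (Suc n). gsrc X n x = f n a \<and> gtgt X n x = f n b \<longrightarrow>
           (\<exists>y\<in>gcells Y (Suc n). gsrc Y n y = a \<and> gtgt Y n y = b \<and> f (Suc n) y = x)))"


section \<open>Disks and spheres\<close>

primrec globe :: "nat \<Rightarrow> tree" where
  "globe 0 = Br []"
| "globe (Suc n) = Br [globe n]"

primrec globe_top :: "nat \<Rightarrow> pos" where
  "globe_top 0 = PInit"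
| "globe_top (Suc n) = PInl (globe_top n)"

definition Disk :: "nat \<Rightarrow> pos computad" where
  "Disk n = Free (Pos (globe n))"

datatype sgn = Neg | Plus

text \<open>\<open>sphere_glob n\<close> is \<open>S\<^bsub>n-1\<^esub>\<close>, with \<open>Neg\<close> and \<open>Plus\<close> in dimension \<open>k\<close>
  standing for the two \<open>k\<close>-cells.\<close>

definition sphere_glob :: "nat \<Rightarrow> sgn glob" where
  "sphere_glob n = \<lparr>gcells = (\<lambda>k. if k < n then {Neg, Plus} else {}),
     gsrc = (\<lambda>k e. Neg), gtgt = (\<lambda>k e. Plus)\<rparr>"

definition Sphere_bd :: "nat \<Rightarrow> sgn computad" where
  "Sphere_bd n = Free (sphere_glob n)"

text \<open>The \<open>k\<close>-dimensional source and target of a \<open>(k+j)\<close>-cell.\<close>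

primrec iter_src :: "('a, 'm) glob_scheme \<Rightarrow> nat \<Rightarrow> nat \<Rightarrow> 'a \<Rightarrow> 'a" where
  "iter_src X k 0 x = x"
| "iter_src X k (Suc j) x = iter_src X k j (gsrc X (k + j) x)"

primrec iter_tgt :: "('a, 'm) glob_scheme \<Rightarrow> nat \<Rightarrow> nat \<Rightarrow> 'a \<Rightarrow> 'a" where
  "iter_tgt X k 0 x = x"
| "iter_tgt X k (Suc j) x = iter_tgt X k j (gtgt X (k + j) x)"

definition iota_glob :: "nat \<Rightarrow> nat \<Rightarrow> sgn \<Rightarrow> pos" where
  "iota_glob n k e = (case e of
       Neg \<Rightarrow> iter_src (Pos (globe n)) k (n - k) (globe_top n)
     | Plus \<Rightarrow> iter_tgt (Pos (globe n)) k (n - k) (globe_top n))"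

definition iota :: "nat \<Rightarrow> nat \<Rightarrow> sgn \<Rightarrow> pos cell" where
  "iota n = Free_map (iota_glob n)"


section \<open>The computad \<open>WX\<close> and the counit \<open>r\<^sub>X\<close>\<close>

text \<open>The homomorphism from a free \<open>\<omega>\<close>-category to \<open>X\<close> extending a map \<open>f\<close> on generators: a
  coherence cell \<open>coh(B, A, \<tau>)\<close> is the value of the free action on \<open>coh(B, A, var \<circ> \<tau>)\<close>, so it has to be
  sent to the value of the action of \<open>X\<close> on \<open>coh(B, A, var \<circ> extend_hom X f \<circ> \<tau>)\<close>.\<close>

primrec extend_hom :: "'a omega_cat \<Rightarrow> (nat \<Rightarrow> 'v \<Rightarrow> 'a) \<Rightarrow> 'v cell \<Rightarrow> 'a" where
  "extend_hom X f (Var n v) = f n v"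
| "extend_hom X f (Coh B A \<tau>) =
     act X (sph_len A) (Coh B A (pos_cut (sph_len A) B (\<lambda>k p. Var k (extend_hom X f (\<tau> k p)))))"

datatype 'a wgen = W0 'a | WPair "'a wgen cell sphere" 'a

primrec wgen_val :: "'a wgen \<Rightarrow> 'a" where
  "wgen_val (W0 x) = x"
| "wgen_val (WPair A x) = x"

primrec wgen_attach :: "'a wgen \<Rightarrow> 'a wgen cell sphere" where
  "wgen_attach (W0 x) = NoSph"
| "wgen_attach (WPair A x) = A"

definition r_hom :: "'a omega_cat \<Rightarrow> nat \<Rightarrow> 'a wgen cell \<Rightarrow> 'a" where
  "r_hom X = (\<lambda>n c. extend_hom X (\<lambda>k g. wgen_val g) c)"

primrec W_upto :: "'a omega_cat \<Rightarrow> nat \<Rightarrow> 'a wgen computad" where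
  "W_upto X 0 = \<lparr>gens = (\<lambda>k. if k = 0 then W0 ` gcells X 0 else {}),
                  attach = (\<lambda>k g. wgen_attach g)\<rparr>"
| "W_upto X (Suc n) = (W_upto X n)\<lparr>gens := (gens (W_upto X n))(Suc n :=
     {WPair A x | A x. A \<in> spheres (W_upto X n) (Suc n) \<and> x \<in> gcells X (Suc n) \<and>
        gsrc X n x = r_hom X n (pr1 A) \<and> gtgt X n x = r_hom X n (pr2 A)})\<rparr>"

definition W_comp :: "'a omega_cat \<Rightarrow> 'a wgen computad" where
  "W_comp X = \<lparr>gens = (\<lambda>n. gens (W_upto X n) n), attach = (\<lambda>k g. wgen_attach g)\<rparr>"

end

theory Submission
  imports Defs
begin

text \<open>
  The \<open>0\<close>-generators of the computad \<open>WX\<close> are the \<open>0\<close>-cells of \<open>X\<close>, and it has, over every sphere \<open>A = (a, b)\<close> of \<open>WX\<close> and every cell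
  \<open>x : r(a) \<rightarrow> r(b)\<close> of \<open>X\<close>, a generator \<open>(A, x) : a \<rightarrow> b\<close> with \<open>r(var(A, x)) = x\<close>.
  So every instance of the local surjectivity problem for \<open>r\<close> is solved by a generator; parallel
  cells \<open>a\<close>, \<open>b\<close> of \<open>WX\<close> form a sphere because the boundary of a cell is determined by its
  source and target (\<open>local_omega_surjection_r\<close>).

  The work is in showing that \<open>r\<close> is a homomorphism of \<open>\<omega>\<close>-categories.  More generally, let
  \<open>f\<close> send generators of a computad \<open>C\<close> to cells of \<open>X\<close>, compatibly with the attaching
  spheres, and let \<open>h\<close> be its recursive extension to cells.  A coherence cell
  \<open>coh(B, A, \<tau>)\<close> goes to the action of \<open>X\<close> on \<open>coh(B, A, var \<circ> h \<circ> \<tau>)\<close>, whose source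
  is the action on the image of \<open>pr\<^sub>1 A\<close> under \<open>var \<circ> h \<circ> \<tau>\<close>, while it should be \<open>h\<close> of
  the image of \<open>pr\<^sub>1 A\<close> under \<open>\<tau>\<close>.  The equation \<open>h(Cell(\<sigma>)(a)) = act(Cell(var \<circ> h \<circ> \<sigma>)(a))\<close>
  for cells \<open>a\<close> of a free computad (\<open>extend_hom_subst\<close>), which is an inductive use of the
  associativity law of \<open>X\<close>, settles this, and with \<open>\<sigma>\<close> the counit of the adjunction between
  \<open>Free\<close> and \<open>Cell\<close> it also gives compatibility with the actions
  (\<open>omega_hom_extend_hom\<close>).

  The lifting property holds for every local \<open>\<omega>\<close>-surjection \<open>Y \<rightarrow> X\<close>
  (\<open>has_rlp_if_local_omega_surjection\<close>).  A lifting problem against \<open>\<iota>\<^sub>n\<close> consists, for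
  \<open>n > 0\<close>, of two parallel cells of \<open>Y\<close> and a cell of \<open>X\<close> between their images, and of a
  \<open>0\<close>-cell of \<open>X\<close> for \<open>n = 0\<close>; surjectivity provides the
  image of the top position of \<open>D\<^sub>n\<close>, the extension result a homomorphism with these values on
  generators, and the uniqueness of homomorphisms with given values on generators
  (\<open>omega_hom_Kw_unique\<close>) the commutativity of both triangles.
\<close>

section \<open>Positions of a Batanin tree\<close>

lemma is_pos_PInit_iff [simp]: "is_pos n B PInit \<longleftrightarrow> n = 0"
  by (auto intro: is_pos.intros elim: is_pos.cases)

lemma is_pos_PInr_iff [simp]:
  "is_pos n B (PInr p) \<longleftrightarrow> (\<exists>B' Bs. B = Br (B' # Bs) \<and> is_pos n (Br Bs) p)"
  by (auto intro: is_pos.intros elim: is_pos.cases)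

lemma is_pos_PInl_iff [simp]:
  "is_pos n B (PInl p) \<longleftrightarrow> (\<exists>m B' Bs. n = Suc m \<and> B = Br (B' # Bs) \<and> is_pos m B' p)"
  by (auto intro: is_pos.intros elim: is_pos.cases)

lemma is_pos_src_tgt:
  "is_pos (Suc n) B p \<Longrightarrow> is_pos n B (pos_src p n) \<and> is_pos n B (pos_tgt p n)"
  by (induction p arbitrary: n B) (auto split: nat.splits)

lemma pos_globular:
  "is_pos (Suc (Suc n)) B p \<Longrightarrow>
     pos_src (pos_src p (Suc n)) n = pos_src (pos_tgt p (Suc n)) n \<and>
     pos_tgt (pos_src p (Suc n)) n = pos_tgt (pos_tgt p (Suc n)) n"
  by (induction p arbitrary: n B) (auto split: nat.splits)

lemma globular_Pos: "globular_set (Pos B)"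
  using is_pos_src_tgt pos_globular by (auto simp: globular_set_def Pos_def)


section \<open>Substitution and homomorphisms of computads\<close>

lemma sph_len_map [simp]: "sph_len (map_sphere f A) = sph_len A"
  by (induction A) auto

lemma map_sphere_of_PCell [simp]: "map_sphere of_pcell (map_sphere PCell A) = A"
  by (simp add: sphere.map_comp o_def sphere.map_ident)

lemma pos_cut_apply: "k \<le> n \<Longrightarrow> p \<in> gcells (Pos B) k \<Longrightarrow> pos_cut n B \<tau> k p = \<tau> k p"
  by (simp add: pos_cut_def)

lemma pos_cut_cong:
  assumes "\<And>k p. k \<le> n \<Longrightarrow> p \<in> gcells (Pos B) k \<Longrightarrow> \<tau> k p = \<tau>' k p"
  shows "pos_cut n B \<tau> = pos_cut n B \<tau>'"
  using assms by (auto simp: pos_cut_def fun_eq_iff)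

lemma pos_cut_idem [simp]: "pos_cut n B (pos_cut n B \<tau>) = pos_cut n B \<tau>"
  by (rule pos_cut_cong) (rule pos_cut_apply)

lemma subst_subst: "subst \<sigma> (subst \<tau> c) = subst (\<lambda>k v. subst \<sigma> (\<tau> k v)) c"
proof (induction c)
  case (Coh B A \<rho>)
  have "pos_cut (sph_len A) B (\<lambda>k p. subst \<sigma> (pos_cut (sph_len A) B (\<lambda>k p. subst \<tau> (\<rho> k p)) k p))
      = pos_cut (sph_len A) B (\<lambda>k p. subst (\<lambda>k v. subst \<sigma> (\<tau> k v)) (\<rho> k p))"
    using Coh[OF rangeI rangeI] by (intro pos_cut_cong) (simp add: pos_cut_apply)
  then show ?case by simp
qed simp

lemma map_sphere_subst_subst:
  "map_sphere (subst \<sigma>) (map_sphere (subst \<tau>) A) = map_sphere (subst (\<lambda>k v. subst \<sigma> (\<tau> k v))) A"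
  by (simp add: sphere.map_comp o_def subst_subst)

text \<open>A coherence cell of dimension \<open>N\<close> stores a homomorphism out of the truncation
  \<open>Free\<^sub>N B\<close>, whose values above \<open>N\<close> are junk; hence the bound.\<close>

definition comp_hom_upto ::
  "nat \<Rightarrow> 'w computad \<Rightarrow> 'v computad \<Rightarrow> (nat \<Rightarrow> 'w \<Rightarrow> 'v cell) \<Rightarrow> bool" where
  "comp_hom_upto N D C \<sigma> \<longleftrightarrow>
     (\<forall>n\<le>N. \<forall>v\<in>gens D n.
        \<sigma> n v \<in> cells C n \<and> bdry C (\<sigma> n v) = map_sphere (subst \<sigma>) (attach D n v))"

lemma gens_Free [simp]: "gens (Free X) = gcells X"
  by (simp add: Free_def)

lemma Var_in_cells: "v \<in> gens C n \<Longrightarrow> Var n v \<in> cells C n"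
  by (simp add: cells_def gen_cell.var)

text \<open>Rule induction for \<open>gen_cell\<close>, with the side conditions on \<open>\<tau>\<close> packed into the statement
  that it is a homomorphism, the form in which functoriality and the adjunction apply to them.\<close>

lemma cells_induct [consumes 1, case_names var coh]:
  assumes "c \<in> cells C n"
    and "\<And>n v. v \<in> gens C n \<Longrightarrow> P n (Var n v)"
    and "\<And>n B A \<tau>. \<lbrakk>sph_len A = n; full B A; tree_dim B \<le> n;
           comp_hom_upto n (Free (Pos B)) C \<tau>; pos_cut n B \<tau> = \<tau>;
           \<And>k p. k \<le> n \<Longrightarrow> p \<in> gcells (Pos B) k \<Longrightarrow> P k (\<tau> k p)\<rbrakk>
         \<Longrightarrow> P n (Coh B (map_sphere PCell A) \<tau>)"
  shows "P n c"
proof -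
  have "gen_cell full C n c" using assms(1) by (simp add: cells_def)
  then show ?thesis
  proof induction
    case (var v n)
    then show ?case by (rule assms(2))
  next
    case (coh A n B \<tau>)
    show ?case
      by (rule assms(3)) (use coh in \<open>auto simp: comp_hom_upto_def cells_def\<close>)
  qed
qed

text \<open>A cell of dimension \<open>n\<close> sees \<open>\<sigma>\<close> only on generators of dimension at most \<open>n\<close>.  This makes
  the default values of \<open>pos_cut\<close> harmless.\<close>

lemma subst_cong_cells:
  assumes "c \<in> cells D n" and "\<And>k v. k \<le> n \<Longrightarrow> v \<in> gens D k \<Longrightarrow> \<sigma> k v = \<sigma>' k v"
  shows "subst \<sigma> c = subst \<sigma>' c"
  using assms
proof (induction rule: cells_induct)
  case (coh n B A \<tau>)
  then show ?case by (auto intro!: pos_cut_cong)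
qed simp

lemma map_sphere_subst_cong:
  assumes "A \<in> spheres D n" and "\<And>k v. k < n \<Longrightarrow> v \<in> gens D k \<Longrightarrow> \<sigma> k v = \<sigma>' k v"
  shows "map_sphere (subst \<sigma>) A = map_sphere (subst \<sigma>') A"
  using assms
proof (induction n arbitrary: A)
  case (Suc n)
  then obtain A' a b where A: "A = Sph A' a b" "A' \<in> spheres D n" "a \<in> cells D n" "b \<in> cells D n"
    by auto
  with Suc show ?case
    by (auto intro!: subst_cong_cells[where \<sigma> = \<sigma>])
qed simp

text \<open>The induction rule of \<open>full\<close> provides cells with respect to the conjunction of \<open>full\<close> and
  the claim; monotonicity of \<open>gen_cell\<close> turns them into ordinary cells.\<close>

lemma full_in_spheres: "full B A \<Longrightarrow> A \<in> spheres (Free (Pos B)) (sph_len A)"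
proof (induction rule: full.induct)
  case (full_0 p B q)
  then show ?case
    by (auto simp: src_boundary_def tgt_boundary_def Free_def intro!: Var_in_cells)
next
  case (full_Suc B A n a b)
  then have "gen_cell full (Free (Pos B)) n a" "gen_cell full (Free (Pos B)) n b"
    by (blast intro: gen_cell_mono[THEN mp, rotated])+
  with full_Suc show ?case by (auto simp: cells_def)
qed

lemma pos_sphere_eq: "pos_sphere X n x y = Sph (attach (Free X) n x) (Var n x) (Var n y)"
  by (cases n) (simp_all add: Free_def)

lemma attach_Free_0 [simp]: "attach (Free X) 0 x = NoSph"
  by (simp add: Free_def)

lemma attach_Free_Suc [simp]:
  "attach (Free X) (Suc n) x =
     Sph (attach (Free X) n (gsrc X n x)) (Var n (gsrc X n x)) (Var n (gtgt X n x))"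
  by (subst (1) Free_def) (simp add: pos_sphere_eq)

lemma is_computad_Free:
  assumes "globular_set X"
  shows "is_computad (Free X)"
proof -
  have "attach (Free X) n x \<in> spheres (Free X) n" if "x \<in> gcells X n" for n x
    using that
  proof (induction n arbitrary: x)
    case (Suc n)
    have st: "gsrc X n x \<in> gcells X n" "gtgt X n x \<in> gcells X n"
      using assms Suc.prems by (auto simp: globular_set_def)
    have "attach (Free X) n (gsrc X n x) = attach (Free X) n (gtgt X n x)"
      using assms Suc.prems by (cases n) (auto simp: globular_set_def)
    with st Suc.IH[OF st(1)] show ?case by (auto intro!: Var_in_cells)
  qed simp
  then show ?thesis by (simp add: is_computad_def)
qed

lemmas is_computad_Free_Pos = is_computad_Free[OF globular_Pos]

lemma Coh_in_cells:
  assumes "sph_len A = n" "full B A" "tree_dim B \<le> n" "comp_hom_upto n (Free (Pos B)) C \<tau>"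
  shows "Coh B (map_sphere PCell A) (pos_cut n B \<tau>) \<in> cells C n"
proof -
  have "gen_cell full C k (pos_cut n B \<tau> k p) \<and>
        bdry C (pos_cut n B \<tau> k p) =
          map_sphere (subst (pos_cut n B \<tau>)) (attach (Free (Pos B)) k p)"
    if k: "k \<le> n" and p: "p \<in> gcells (Pos B) k" for k p
  proof -
    have "attach (Free (Pos B)) k p \<in> spheres (Free (Pos B)) k"
      using is_computad_Free_Pos p by (auto simp: is_computad_def)
    then have "map_sphere (subst (pos_cut n B \<tau>)) (attach (Free (Pos B)) k p) =
        map_sphere (subst \<tau>) (attach (Free (Pos B)) k p)"
      by (rule map_sphere_subst_cong) (use k in \<open>auto simp: pos_cut_apply\<close>)
    then show ?thesis
      using assms(4) k p by (simp add: comp_hom_upto_def cells_def pos_cut_apply)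
  qed
  then show ?thesis
    using assms by (auto simp: cells_def intro!: gen_cell.coh)
qed

lemma bdry_Coh:
  assumes "sph_len A = n" "full B A"
  shows "bdry C (Coh B (map_sphere PCell A) (pos_cut n B \<tau>)) = map_sphere (subst \<tau>) A"
proof -
  have "map_sphere (subst (pos_cut n B \<tau>)) A = map_sphere (subst \<tau>) A"
    using full_in_spheres[OF assms(2)]
    by (rule map_sphere_subst_cong) (use assms in \<open>auto simp: pos_cut_apply\<close>)
  then show ?thesis by simp
qed

text \<open>Functoriality of cells along a homomorphism; in the coherence case it is proved together
  with the fact that homomorphisms compose.\<close>

lemma subst_cell:
  assumes "c \<in> cells D n" "comp_hom_upto N D C \<sigma>" "n \<le> N"
  shows "subst \<sigma> c \<in> cells C n \<and> bdry C (subst \<sigma> c) = map_sphere (subst \<sigma>) (bdry D c)"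
  using assms
proof (induction rule: cells_induct)
  case (var n v)
  then show ?case by (simp add: comp_hom_upto_def)
next
  case (coh n B A \<tau>)
  have hom: "comp_hom_upto n (Free (Pos B)) C (\<lambda>k p. subst \<sigma> (\<tau> k p))"
    unfolding comp_hom_upto_def
  proof (intro allI impI ballI)
    fix k p
    assume k: "k \<le> n" and p: "p \<in> gens (Free (Pos B)) k"
    then have "bdry D (\<tau> k p) = map_sphere (subst \<tau>) (attach (Free (Pos B)) k p)"
      using coh(4) by (simp add: comp_hom_upto_def)
    moreover have "subst \<sigma> (\<tau> k p) \<in> cells C k \<and>
        bdry C (subst \<sigma> (\<tau> k p)) = map_sphere (subst \<sigma>) (bdry D (\<tau> k p))"
      using coh k p by simp
    ultimately show "subst \<sigma> (\<tau> k p) \<in> cells C k \<and>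
        bdry C (subst \<sigma> (\<tau> k p)) =
          map_sphere (subst (\<lambda>k p. subst \<sigma> (\<tau> k p))) (attach (Free (Pos B)) k p)"
      by (simp add: map_sphere_subst_subst)
  qed
  have eq: "subst \<sigma> (Coh B (map_sphere PCell A) \<tau>) =
      Coh B (map_sphere PCell A) (pos_cut n B (\<lambda>k p. subst \<sigma> (\<tau> k p)))"
    using coh(1) by simp
  have "bdry C (Coh B (map_sphere PCell A) (pos_cut n B (\<lambda>k p. subst \<sigma> (\<tau> k p)))) =
      map_sphere (subst \<sigma>) (bdry D (Coh B (map_sphere PCell A) \<tau>))"
    using bdry_Coh[OF coh(1,2)] by (simp add: map_sphere_subst_subst)
  with Coh_in_cells[OF coh(1,2,3) hom] eq show ?case by simp
qed

lemma comp_hom_upto_comp: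
  assumes "comp_hom_upto N E D \<tau>" "comp_hom_upto N D C \<sigma>"
  shows "comp_hom_upto N E C (\<lambda>k v. subst \<sigma> (\<tau> k v))"
  using assms(1) subst_cell[OF _ assms(2)]
  by (fastforce simp: comp_hom_upto_def map_sphere_subst_subst[symmetric])

lemma map_sphere_subst_in_spheres:
  assumes "comp_hom_upto N D C \<sigma>" "A \<in> spheres D n" "n \<le> N"
  shows "map_sphere (subst \<sigma>) A \<in> spheres C n"
  using assms(2,3)
proof (induction n arbitrary: A)
  case (Suc n)
  then obtain A' a b where "A = Sph A' a b" "A' \<in> spheres D n" "a \<in> cells D n" "b \<in> cells D n"
    "bdry D a = A'" "bdry D b = A'"
    by auto
  with Suc subst_cell[OF _ assms(1)] show ?case by auto
qed simp

lemma bdry_in_spheres: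
  assumes "is_computad C" "c \<in> cells C n"
  shows "bdry C c \<in> spheres C n"
  using assms(2)
proof (induction rule: cells_induct)
  case (var n v)
  then show ?case using assms(1) by (simp add: is_computad_def)
next
  case (coh n B A \<tau>)
  then show ?case
    using map_sphere_subst_in_spheres[OF coh(4)] full_in_spheres[OF coh(2)] by simp
qed

lemma bdry_cell_0:
  assumes "is_computad C" "c \<in> cells C 0"
  shows "bdry C c = NoSph"
  using bdry_in_spheres[OF assms] by simp

lemma bdry_cell_Suc:
  assumes "is_computad C" "c \<in> cells C (Suc n)"
  obtains a b where "bdry C c = Sph (bdry C a) a b" "a \<in> cells C n" "b \<in> cells C n"
    "bdry C b = bdry C a"
  using bdry_in_spheres[OF assms] by auto

lemma Cell_sel [simp]:
  "gcells (Cell C) = cells C" "gsrc (Cell C) n c = pr1 (bdry C c)" "gtgt (Cell C) n c = pr2 (bdry C c)"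
  by (simp_all add: Cell_def)

lemma globular_Cell:
  assumes C: "is_computad C"
  shows "globular_set (Cell C)"
  unfolding globular_set_def
proof (intro conjI allI ballI)
  fix n c
  assume "c \<in> gcells (Cell C) (Suc n)"
  then have "c \<in> cells C (Suc n)" by simp
  from bdry_cell_Suc[OF C this]
  show "gsrc (Cell C) n c \<in> gcells (Cell C) n" "gtgt (Cell C) n c \<in> gcells (Cell C) n"
    by (metis Cell_sel sphere.sel)+
next
  fix n c
  assume "c \<in> gcells (Cell C) (Suc (Suc n))"
  then have "c \<in> cells C (Suc (Suc n))" by simp
  from bdry_cell_Suc[OF C this]
  show "gsrc (Cell C) n (gsrc (Cell C) (Suc n) c) = gsrc (Cell C) n (gtgt (Cell C) (Suc n) c)"
    "gtgt (Cell C) n (gsrc (Cell C) (Suc n) c) = gtgt (Cell C) n (gtgt (Cell C) (Suc n) c)"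
    by (metis Cell_sel sphere.sel)+
qed


section \<open>The adjunction between globular sets and computads\<close>

definition glob_map_upto ::
  "nat \<Rightarrow> ('a, 'm) glob_scheme \<Rightarrow> ('b, 'l) glob_scheme \<Rightarrow> (nat \<Rightarrow> 'a \<Rightarrow> 'b) \<Rightarrow> bool" where
  "glob_map_upto N X Y f \<longleftrightarrow>
     (\<forall>n\<le>N. \<forall>x\<in>gcells X n. f n x \<in> gcells Y n) \<and>
     (\<forall>n<N. \<forall>x\<in>gcells X (Suc n).
        f n (gsrc X n x) = gsrc Y n (f (Suc n) x) \<and>
        f n (gtgt X n x) = gtgt Y n (f (Suc n) x))"

lemma glob_map_imp_upto: "glob_map X Y f \<Longrightarrow> glob_map_upto N X Y f"
  by (simp add: glob_map_def glob_map_upto_def)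

text \<open>The two transpositions of the adjunction between \<open>Free\<close> and \<open>Cell\<close>, truncated at \<open>N\<close>.
  In the second one the attaching spheres come for free, since the boundary of a cell is
  determined by the source and target and, recursively, by the boundary of the source.\<close>

lemma comp_hom_upto_imp_glob_map_upto:
  assumes "comp_hom_upto N (Free Y) C \<sigma>"
  shows "glob_map_upto N Y (Cell C) \<sigma>"
  using assms by (auto simp: glob_map_upto_def comp_hom_upto_def Suc_le_eq)

lemma glob_map_upto_imp_comp_hom_upto:
  assumes Y: "globular_set Y" and C: "is_computad C" and g: "glob_map_upto N Y (Cell C) \<sigma>"
  shows "comp_hom_upto N (Free Y) C \<sigma>"
proof -
  have "bdry C (\<sigma> n y) = map_sphere (subst \<sigma>) (attach (Free Y) n y)"
    if "n \<le> N" "y \<in> gcells Y n" for n y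
    using that
  proof (induction n arbitrary: y)
    case 0
    then show ?case using g bdry_cell_0[OF C] by (simp add: glob_map_upto_def)
  next
    case (Suc n)
    have "\<sigma> (Suc n) y \<in> cells C (Suc n)" using g Suc.prems by (auto simp: glob_map_upto_def)
    then obtain a b where ab: "bdry C (\<sigma> (Suc n) y) = Sph (bdry C a) a b"
      using bdry_cell_Suc[OF C] by metis
    then have "\<sigma> n (gsrc Y n y) = a" "\<sigma> n (gtgt Y n y) = b"
      using g Suc.prems by (auto simp: glob_map_upto_def Suc_le_eq)
    moreover have "gsrc Y n y \<in> gcells Y n" using Y Suc.prems by (auto simp: globular_set_def)
    ultimately show ?case using ab Suc.IH[of "gsrc Y n y"] Suc.prems by auto
  qed
  then show ?thesis using g by (simp add: comp_hom_upto_def glob_map_upto_def)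
qed

lemma glob_map_upto_Var:
  assumes "glob_map_upto N Y X g"
  shows "glob_map_upto N Y (Cell (Free X)) (\<lambda>k y. Var k (g k y))"
  using assms by (auto simp: glob_map_upto_def Var_in_cells)

lemma comp_hom_upto_Var:
  assumes "globular_set Y" "globular_set X" "glob_map_upto N Y X g"
  shows "comp_hom_upto N (Free Y) (Free X) (\<lambda>k y. Var k (g k y))"
  by (intro glob_map_upto_imp_comp_hom_upto is_computad_Free glob_map_upto_Var assms)


section \<open>Free omega-categories\<close>

lemma Kw_sel [simp]:
  "gcells (Kw C) = cells C" "gsrc (Kw C) n c = pr1 (bdry C c)" "gtgt (Kw C) n c = pr2 (bdry C c)"
  "act (Kw C) = Cell_map counit"
  by (simp_all add: Kw_def)

lemma fc_sel [simp]: "gcells (fc X) = cells (Free X)"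
  by (simp add: fc_def)

lemma fc_map_apply: "fc_map f n c = subst (\<lambda>k v. Var k (f k v)) c"
  by (simp add: fc_map_def Cell_map_def Free_map_def)

lemma omega_hom_Kw_src_tgt:
  assumes "omega_hom (Kw C) X u" "c \<in> cells C (Suc n)"
  shows "gsrc X n (u (Suc n) c) = u n (pr1 (bdry C c))" "gtgt X n (u (Suc n) c) = u n (pr2 (bdry C c))"
  using assms by (simp_all add: omega_hom_def glob_map_def)

lemma globular_Kw: "is_computad C \<Longrightarrow> globular_set (Kw C)"
  using globular_Cell[of C] by (simp add: globular_set_def)

lemma comp_hom_counit:
  assumes "is_computad C"
  shows "comp_hom_upto N (Free (Kw C)) C counit"
  by (intro glob_map_upto_imp_comp_hom_upto globular_Kw assms)
    (simp add: glob_map_upto_def counit_def)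

lemma glob_map_subst:
  assumes "\<And>N. comp_hom_upto N D C \<sigma>" "is_computad D"
  shows "glob_map (Kw D) (Kw C) (Cell_map \<sigma>)"
  unfolding glob_map_def
proof (intro conjI allI ballI)
  fix n c
  assume "c \<in> gcells (Kw D) n"
  then show "Cell_map \<sigma> n c \<in> gcells (Kw C) n"
    using subst_cell[OF _ assms(1)] by (auto simp: Cell_map_def)
next
  fix n c
  assume "c \<in> gcells (Kw D) (Suc n)"
  then have c: "c \<in> cells D (Suc n)" by simp
  obtain a b where "bdry D c = Sph (bdry D a) a b" using bdry_cell_Suc[OF assms(2) c] by metis
  then show "Cell_map \<sigma> n (gsrc (Kw D) n c) = gsrc (Kw C) n (Cell_map \<sigma> (Suc n) c)"
    "Cell_map \<sigma> n (gtgt (Kw D) n c) = gtgt (Kw C) n (Cell_map \<sigma> (Suc n) c)"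
    using subst_cell[OF c assms(1) order.refl] by (auto simp: Cell_map_def)
qed

lemma is_omega_cat_Kw:
  assumes "is_computad C"
  shows "is_omega_cat (Kw C)"
proof -
  have "glob_map (fc (Kw C)) (Kw C) (Cell_map counit)"
    using glob_map_subst[OF comp_hom_counit[OF assms] is_computad_Free[OF globular_Kw[OF assms]]]
    by (simp add: glob_map_def fc_def)
  then show ?thesis
    using globular_Kw[OF assms]
    by (simp add: is_omega_cat_def Cell_map_def counit_def fc_mult_def fc_map_apply subst_subst)
qed

lemma omega_hom_Cell_map:
  assumes "\<And>N. comp_hom_upto N D C \<sigma>" "is_computad D"
  shows "omega_hom (Kw D) (Kw C) (Cell_map \<sigma>)"
  using glob_map_subst[OF assms]
  by (simp add: omega_hom_def fc_map_apply Cell_map_def counit_def subst_subst)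

lemma omega_hom_comp:
  assumes Z: "is_omega_cat Z" and f: "omega_hom Z Y f" and g: "omega_hom Y X g" and Y: "globular_set Y"
  shows "omega_hom Z X (\<lambda>n z. g n (f n z))"
proof -
  have f': "glob_map Z Y f" using f by (simp add: omega_hom_def)
  have "g n (f n (act Z n c)) = act X n (fc_map (\<lambda>n z. g n (f n z)) n c)"
    if c: "c \<in> cells (Free Z) n" for n c
  proof -
    have "comp_hom_upto n (Free Z) (Free Y) (\<lambda>k y. Var k (f k y))"
      using Z Y f' by (intro comp_hom_upto_Var glob_map_imp_upto) (simp_all add: is_omega_cat_def)
    from subst_cell[OF c this order.refl] have "fc_map f n c \<in> cells (Free Y) n"
      by (simp add: fc_map_apply)
    then have "g n (act Y n (fc_map f n c)) = act X n (fc_map g n (fc_map f n c))"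
      using g by (simp add: omega_hom_def)
    then show ?thesis using f c by (simp add: omega_hom_def fc_map_apply subst_subst)
  qed
  then show ?thesis using f g by (simp add: omega_hom_def glob_map_def)
qed

text \<open>A free \<open>\<omega>\<close>-category is generated by its generators: the cell \<open>coh(B, A, \<tau>)\<close> of \<open>C\<close> is the
  value of the action on \<open>coh(B, A, var \<circ> \<tau>)\<close>, so its image is determined by the images of the
  cells \<open>\<tau>(p)\<close>.\<close>

lemma omega_hom_Kw_unique:
  assumes C: "is_computad C"
    and u: "omega_hom (Kw C) X u" and v: "omega_hom (Kw C) X v"
    and eq: "\<And>n g. g \<in> gens C n \<Longrightarrow> u n (Var n g) = v n (Var n g)"
    and c: "c \<in> cells C n"
  shows "u n c = v n c"
  using c
proof (induction rule: cells_induct)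
  case (var n g)
  then show ?case by (rule eq)
next
  case (coh n B A \<tau>)
  \<comment> \<open>\<open>c'\<close> is the cell over the free \<open>\<omega>\<close>-category whose composite is \<open>coh(B, A, \<tau>)\<close>\<close>
  define c' where "c' = Coh B (map_sphere PCell A) (pos_cut n B (\<lambda>k p. Var k (\<tau> k p)))"
  have "glob_map_upto n (Pos B) (Cell C) \<tau>"
    using coh(4) by (rule comp_hom_upto_imp_glob_map_upto)
  then have "comp_hom_upto n (Free (Pos B)) (Free (Kw C)) (\<lambda>k p. Var k (\<tau> k p))"
    by (intro comp_hom_upto_Var globular_Pos globular_Kw C) (simp add: glob_map_upto_def)
  then have c': "c' \<in> cells (Free (Kw C)) n"
    using Coh_in_cells coh(1,2,3) unfolding c'_def by blast
  have "pos_cut n B (\<lambda>k p. subst counit (pos_cut n B (\<lambda>k p. Var k (\<tau> k p)) k p)) = pos_cut n B \<tau>"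
    by (rule pos_cut_cong) (simp add: pos_cut_apply counit_def)
  then have act: "act (Kw C) n c' = Coh B (map_sphere PCell A) \<tau>"
    using coh(1,5) by (simp add: c'_def Cell_map_def)
  have "pos_cut n B (\<lambda>k p. subst (\<lambda>k v. Var k (u k v)) (pos_cut n B (\<lambda>k p. Var k (\<tau> k p)) k p)) =
        pos_cut n B (\<lambda>k p. subst (\<lambda>k w. Var k (v k w)) (pos_cut n B (\<lambda>k p. Var k (\<tau> k p)) k p))"
    by (rule pos_cut_cong) (simp add: pos_cut_apply coh(6))
  then have "fc_map u n c' = fc_map v n c'"
    using coh(1) by (simp add: c'_def fc_map_apply)
  then show ?case
    using u v c' act by (metis fc_sel omega_hom_def)
qed


section \<open>Extending maps on generators to homomorphisms\<close>

text \<open>The associativity law of \<open>X\<close> makes \<open>extend_hom X f\<close> compatible with substitution: if all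
  \<open>h(\<sigma>(y))\<close> form a globular map \<open>g\<close> into \<open>X\<close>, where \<open>h\<close> is the extension, then \<open>h\<close> evaluates
  \<open>Cell(\<sigma>)(a)\<close> as the composite of the pasting diagram \<open>a\<close> with entries \<open>g(y)\<close>.  With \<open>Y\<close> a
  tree this computes the boundary of a coherence cell, and with \<open>\<sigma>\<close> the counit it says that
  \<open>h\<close> commutes with the actions.\<close>

lemma extend_hom_subst:
  fixes X :: "'a omega_cat" and f :: "nat \<Rightarrow> 'v \<Rightarrow> 'a" and \<sigma> :: "nat \<Rightarrow> 'y \<Rightarrow> 'v cell"
  defines "g \<equiv> \<lambda>k y. extend_hom X f (\<sigma> k y)"
  assumes X: "is_omega_cat X" and Y: "globular_set Y"
    and g: "glob_map_upto N Y X g" and a: "a \<in> cells (Free Y) n" and n: "n \<le> N"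
  shows "extend_hom X f (subst \<sigma> a) = act X n (subst (\<lambda>k y. Var k (g k y)) a)"
proof -
  have X': "globular_set X" using X by (simp add: is_omega_cat_def)
  have fcX: "globular_set (fc X)"
    unfolding fc_def by (intro globular_Cell is_computad_Free X')
  define \<gamma> where "\<gamma> = (\<lambda>k y. Var k (g k y) :: 'a cell)"
  have \<gamma>: "comp_hom_upto N (Free Y) (Free X) \<gamma>"
    unfolding \<gamma>_def by (intro comp_hom_upto_Var Y X' g)
  show ?thesis
    using a n unfolding \<gamma>_def[symmetric]
  proof (induction rule: cells_induct)
    case (var n y)
    then show ?case
      using X g by (simp add: \<gamma>_def g_def glob_map_upto_def is_omega_cat_def)
  next
    case (coh n B A \<rho>)
    define A' where "A' = map_sphere PCell A"
    have len: "sph_len A' = n" using coh(1) by (simp add: A'_def)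
    \<comment> \<open>associativity at this two-level pasting diagram is the claim for \<open>coh(B, A, \<rho>)\<close>: its
      multiplication is the right-hand side, and the induction hypothesis identifies
      the result of composing it inside first with the left-hand side\<close>
    define c where "c = Coh B A' (pos_cut n B (\<lambda>k p. Var k (subst \<gamma> (\<rho> k p))))"
    have "comp_hom_upto n (Free Y) (Free X) \<gamma>"
      using \<gamma> coh.prems by (simp add: comp_hom_upto_def)
    then have "comp_hom_upto n (Free (Pos B)) (Free X) (\<lambda>k p. subst \<gamma> (\<rho> k p))"
      using coh(4) comp_hom_upto_comp by blast
    then have "glob_map_upto n (Pos B) (fc X) (\<lambda>k p. subst \<gamma> (\<rho> k p))"
      unfolding fc_def by (rule comp_hom_upto_imp_glob_map_upto)
    then have "comp_hom_upto n (Free (Pos B)) (Free (fc X)) (\<lambda>k p. Var k (subst \<gamma> (\<rho> k p)))"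
      by (intro comp_hom_upto_Var globular_Pos fcX)
    then have "c \<in> cells (Free (fc X)) n"
      using Coh_in_cells coh(1,2,3) unfolding c_def A'_def by blast
    then have law: "act X n (fc_mult n c) = act X n (fc_map (act X) n c)"
      using X by (simp add: is_omega_cat_def)
    have "pos_cut n B (\<lambda>k p. subst counit (pos_cut n B (\<lambda>k p. Var k (subst \<gamma> (\<rho> k p))) k p)) =
        pos_cut n B (\<lambda>k p. subst \<gamma> (\<rho> k p))"
      by (rule pos_cut_cong) (simp add: pos_cut_apply counit_def)
    then have mult: "fc_mult n c = subst \<gamma> (Coh B A' \<rho>)"
      by (simp add: fc_mult_def c_def Cell_map_def len)
    have "pos_cut n B (\<lambda>k p. Var k (extend_hom X f
            (pos_cut n B (\<lambda>k p. subst \<sigma> (\<rho> k p)) k p)) :: 'a cell) =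
        pos_cut n B (\<lambda>k p. subst (\<lambda>k v. Var k (act X k v))
            (pos_cut n B (\<lambda>k p. Var k (subst \<gamma> (\<rho> k p))) k p))"
      by (rule pos_cut_cong) (use coh in \<open>simp add: pos_cut_apply\<close>)
    then have "extend_hom X f (subst \<sigma> (Coh B A' \<rho>)) = act X n (fc_map (act X) n c)"
      by (simp add: fc_map_apply c_def len)
    with law mult show ?case by (simp add: A'_def)
  qed
qed

text \<open>That the extension \<open>h\<close> of \<open>f\<close> preserves
  sources and targets and that it lands in \<open>X\<close> must be proved in one induction: for
  \<open>coh(B, A, \<tau>)\<close> both facts, at the cells \<open>\<tau>(p)\<close>, are needed to see that \<open>h \<circ> \<tau>\<close> is a
  globular map, so that the action of \<open>X\<close> is applied to a genuine cell.\<close>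

lemma omega_hom_extend_hom:
  assumes X: "is_omega_cat X" and C: "is_computad C"
    and cell: "\<And>n v. v \<in> gens C n \<Longrightarrow> f n v \<in> gcells X n"
    and src: "\<And>n v. v \<in> gens C (Suc n) \<Longrightarrow>
                gsrc X n (f (Suc n) v) = extend_hom X f (pr1 (attach C (Suc n) v))"
    and tgt: "\<And>n v. v \<in> gens C (Suc n) \<Longrightarrow>
                gtgt X n (f (Suc n) v) = extend_hom X f (pr2 (attach C (Suc n) v))"
  shows "omega_hom (Kw C) X (\<lambda>n. extend_hom X f)"
proof -
  let ?h = "extend_hom X f"
  have X': "globular_set X" and aX: "glob_map (fc X) X (act X)"
    using X by (simp_all add: is_omega_cat_def)
  have glob: "?h c \<in> gcells X n \<and>
      (\<forall>m. n = Suc m \<longrightarrow> gsrc X m (?h c) = ?h (pr1 (bdry C c)) \<and> gtgt X m (?h c) = ?h (pr2 (bdry C c)))"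
    if "c \<in> cells C n" for n c
    using that
  proof (induction rule: cells_induct)
    case (var n v)
    then show ?case using cell src tgt by auto
  next
    case (coh n B A \<tau>)
    define g where "g = (\<lambda>k p. ?h (\<tau> k p))"
    have g: "glob_map_upto n (Pos B) X g"
      unfolding glob_map_upto_def
    proof (intro conjI allI impI ballI)
      fix k p
      assume "k \<le> n" "p \<in> gcells (Pos B) k"
      then show "g k p \<in> gcells X k" using coh(6) by (simp add: g_def)
    next
      fix k p
      assume k: "k < n" and p: "p \<in> gcells (Pos B) (Suc k)"
      then have "bdry C (\<tau> (Suc k) p) = map_sphere (subst \<tau>) (attach (Free (Pos B)) (Suc k) p)"
        using coh(4) by (simp add: comp_hom_upto_def)
      then show "g k (gsrc (Pos B) k p) = gsrc X k (g (Suc k) p)"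
        "g k (gtgt (Pos B) k p) = gtgt X k (g (Suc k) p)"
        using coh(6)[of "Suc k" p] k p by (auto simp: g_def)
    qed
    define \<gamma> where "\<gamma> = (\<lambda>k p. Var k (g k p) :: 'a cell)"
    have \<gamma>: "comp_hom_upto n (Free (Pos B)) (Free X) \<gamma>"
      unfolding \<gamma>_def by (intro comp_hom_upto_Var globular_Pos X' g)
    define c where "c = Coh B (map_sphere PCell A) (pos_cut n B \<gamma>)"
    have c: "c \<in> cells (Free X) n"
      unfolding c_def by (intro Coh_in_cells coh(1,2,3) \<gamma>)
    have hc: "?h (Coh B (map_sphere PCell A) \<tau>) = act X n c"
      using coh(1) by (simp add: c_def \<gamma>_def g_def)
    have "gsrc X m (act X n c) = ?h (subst \<tau> (pr1 A)) \<and> gtgt X m (act X n c) = ?h (subst \<tau> (pr2 A))"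
      and "A \<noteq> NoSph" if n: "n = Suc m" for m
    proof -
      obtain A' a b where A: "A = Sph A' a b" and ab: "a \<in> cells (Free (Pos B)) m" "b \<in> cells (Free (Pos B)) m"
        using full_in_spheres[OF coh(2)] coh(1) n by auto
      then show "A \<noteq> NoSph" by simp
      have "bdry (Free X) c = map_sphere (subst \<gamma>) A"
        unfolding c_def by (rule bdry_Coh) (use coh in auto)
      moreover have "gsrc X m (act X n c) = act X m (pr1 (bdry (Free X) c)) \<and>
          gtgt X m (act X n c) = act X m (pr2 (bdry (Free X) c))"
        using aX c n by (simp add: glob_map_def fc_def)
      moreover have "?h (subst \<tau> a) = act X m (subst \<gamma> a)" "?h (subst \<tau> b) = act X m (subst \<gamma> b)"
        unfolding \<gamma>_def g_def
        by (rule extend_hom_subst[OF X globular_Pos _ _ , where N = n]; use g ab n in \<open>simp add: g_def\<close>)+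
      ultimately show "gsrc X m (act X n c) = ?h (subst \<tau> (pr1 A)) \<and>
          gtgt X m (act X n c) = ?h (subst \<tau> (pr2 A))"
        using A by simp
    qed
    moreover have "act X n c \<in> gcells X n" using aX c by (simp add: glob_map_def)
    ultimately show ?case unfolding hc by (cases A) auto
  qed
  have map: "glob_map (Kw C) X (\<lambda>n. ?h)"
    using glob by (auto simp: glob_map_def)
  have "?h (act (Kw C) n c) = act X n (fc_map (\<lambda>n. ?h) n c)" if "c \<in> cells (Free (Kw C)) n" for n c
  proof -
    have "glob_map_upto n (Kw C) X (\<lambda>k y. ?h (counit k y))"
      using glob_map_imp_upto[OF map] by (simp add: counit_def)
    then show ?thesis
      using extend_hom_subst[OF X globular_Kw[OF C] _ that order.refl, where f = f and \<sigma> = counit]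
      by (simp add: fc_map_apply Cell_map_def counit_def)
  qed
  with map show ?thesis by (simp add: omega_hom_def)
qed


section \<open>The computad underlying an omega-category\<close>

lemma bdry_cong: "attach C = attach D \<Longrightarrow> bdry C c = bdry D c"
  by (cases c) simp_all

text \<open>The truncations \<open>W_upto X n\<close> and \<open>W_comp X\<close> share generators up to dimension \<open>n\<close>, and
  cells and spheres of dimension \<open>n\<close> depend on these only.  Thus the recursion equation for
  the generators can be stated in \<open>W_comp X\<close> itself (\<open>gens_W_comp_Suc\<close>).\<close>

lemma cells_mono_upto:
  assumes "c \<in> cells C n" "attach C = attach D" "\<And>k. k \<le> n \<Longrightarrow> gens C k \<subseteq> gens D k"
  shows "c \<in> cells D n"
  using assms(1,3)
proof (induction rule: cells_induct)
  case (var n v)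
  then show ?case by (auto intro!: Var_in_cells)
next
  case (coh n B A \<tau>)
  have "comp_hom_upto n (Free (Pos B)) D \<tau>"
    using coh bdry_cong[OF assms(2)] by (simp add: comp_hom_upto_def)
  from Coh_in_cells[OF coh(1,2,3) this] show ?case using coh(5) by simp
qed

lemma spheres_mono_upto:
  assumes "A \<in> spheres C n" "attach C = attach D" "\<And>k. k < n \<Longrightarrow> gens C k \<subseteq> gens D k"
  shows "A \<in> spheres D n"
  using assms(1,3)
proof (induction n arbitrary: A)
  case (Suc n)
  then show ?case
    using cells_mono_upto[OF _ assms(2), of _ n] bdry_cong[OF assms(2)] by fastforce
qed simp

lemma attach_W_upto [simp]: "attach (W_upto X n) = (\<lambda>k g. wgen_attach g)"
  by (induction n) simp_all

lemma attach_W_comp [simp]: "attach (W_comp X) k g = wgen_attach g"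
  by (simp add: W_comp_def)

lemma gens_W_upto: "k \<le> n \<Longrightarrow> gens (W_upto X n) k = gens (W_comp X) k"
  by (induction n) (auto simp: W_comp_def le_Suc_eq)

lemma spheres_W_upto: "spheres (W_upto X n) (Suc n) = spheres (W_comp X) (Suc n)"
proof -
  have "attach (W_upto X n) = attach (W_comp X)" by (simp add: fun_eq_iff)
  then show ?thesis
    using gens_W_upto[of _ n X] by (auto simp del: spheres.simps elim!: spheres_mono_upto)
qed

lemma gens_W_comp_0: "gens (W_comp X) 0 = W0 ` gcells X 0"
  by (simp add: W_comp_def)

lemma gens_W_comp_Suc:
  "gens (W_comp X) (Suc n) =
     {WPair A x | A x. A \<in> spheres (W_comp X) (Suc n) \<and> x \<in> gcells X (Suc n) \<and>
        gsrc X n x = r_hom X n (pr1 A) \<and> gtgt X n x = r_hom X n (pr2 A)}"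
  unfolding spheres_W_upto[symmetric] by (simp add: W_comp_def)

lemma is_computad_W_comp: "is_computad (W_comp X)"
  unfolding is_computad_def
proof (intro allI ballI)
  fix n v
  assume "v \<in> gens (W_comp X) n"
  then show "attach (W_comp X) n v \<in> spheres (W_comp X) n"
    by (cases n) (auto simp del: spheres.simps(2) simp: gens_W_comp_0 gens_W_comp_Suc)
qed

lemma omega_hom_r:
  assumes "is_omega_cat X"
  shows "omega_hom (Kw (W_comp X)) X (r_hom X)"
  unfolding r_hom_def
proof (rule omega_hom_extend_hom[OF assms is_computad_W_comp])
  fix n v
  assume "v \<in> gens (W_comp X) n"
  then show "wgen_val v \<in> gcells X n"
    by (cases n) (auto simp: gens_W_comp_0 gens_W_comp_Suc)
qed (auto simp: gens_W_comp_Suc r_hom_def)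

text \<open>The generator \<open>(A, x)\<close> over the sphere \<open>A\<close> formed by \<open>a\<close> and \<open>b\<close> is the required cell.\<close>

lemma local_omega_surjection_r:
  fixes X :: "'a omega_cat"
  shows "local_omega_surjection (Kw (W_comp X)) X (r_hom X)"
  unfolding local_omega_surjection_def
proof (intro conjI ballI allI impI)
  fix x
  assume "x \<in> gcells X 0"
  then have "Var 0 (W0 x) \<in> gcells (Kw (W_comp X)) 0"
    by (simp add: Var_in_cells gens_W_comp_0)
  then show "\<exists>y\<in>gcells (Kw (W_comp X)) 0. r_hom X 0 y = x"
    by (rule rev_bexI) (simp add: r_hom_def)
next
  let ?C = "W_comp X"
  fix n a b x
  assume ab: "a \<in> gcells (Kw ?C) n" "b \<in> gcells (Kw ?C) n"
    and par: "\<forall>m. n = Suc m \<longrightarrow> gsrc (Kw ?C) m a = gsrc (Kw ?C) m b \<and> gtgt (Kw ?C) m a = gtgt (Kw ?C) m b"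
    and x: "x \<in> gcells X (Suc n)" "gsrc X n x = r_hom X n a \<and> gtgt X n x = r_hom X n b"
  have "bdry ?C a = bdry ?C b"
  proof (cases n)
    case 0
    then show ?thesis using ab bdry_cell_0[OF is_computad_W_comp] by (metis Kw_sel(1))
  next
    case (Suc m)
    then obtain s t s' t' where "bdry ?C a = Sph (bdry ?C s) s t" "bdry ?C b = Sph (bdry ?C s') s' t'"
      using ab bdry_cell_Suc[OF is_computad_W_comp] by (metis Kw_sel(1))
    with par Suc show ?thesis by simp
  qed
  then have A: "Sph (bdry ?C a) a b \<in> spheres ?C (Suc n)"
    using ab bdry_in_spheres[OF is_computad_W_comp] by auto
  define y :: "'a wgen cell" where "y = Var (Suc n) (WPair (Sph (bdry ?C a) a b) x)"
  have "y \<in> gcells (Kw ?C) (Suc n)"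
    using A x by (auto simp del: spheres.simps(2) simp: y_def gens_W_comp_Suc intro!: Var_in_cells)
  then show "\<exists>y\<in>gcells (Kw ?C) (Suc n). gsrc (Kw ?C) n y = a \<and> gtgt (Kw ?C) n y = b \<and> r_hom X (Suc n) y = x"
    by (rule rev_bexI) (simp add: y_def r_hom_def)
qed


section \<open>Lifting against the inclusions of spheres into disks\<close>

text \<open>The names do not depend on \<open>n\<close>: in dimension \<open>k < n\<close> they name the two positions of
  \<open>globe n\<close>, and the top position of \<open>globe n\<close> is \<open>globe_pos n Neg\<close>.\<close>

primrec globe_pos :: "nat \<Rightarrow> sgn \<Rightarrow> pos" where
  "globe_pos 0 e = (case e of Neg \<Rightarrow> PInit | Plus \<Rightarrow> PInr PInit)"
| "globe_pos (Suc k) e = PInl (globe_pos k e)"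

lemma globe_top_eq: "globe_top n = globe_pos n Neg"
  by (induction n) simp_all

lemma globe_pos_inject: "globe_pos k Plus \<noteq> globe_pos k Neg"
  by (induction k) simp_all

lemma src_globe_pos: "pos_src (globe_pos (Suc k) e) k = globe_pos k Neg"
  and tgt_globe_pos: "pos_tgt (globe_pos (Suc k) e) k = globe_pos k Plus"
  by (induction k) simp_all

lemma is_pos_globe:
  "is_pos k (globe n) p \<longleftrightarrow>
     (k < n \<and> (p = globe_pos k Neg \<or> p = globe_pos k Plus)) \<or> (k = n \<and> p = globe_pos n Neg)"
proof (induction n arbitrary: k p)
  case 0
  then show ?case by (cases p) auto
next
  case (Suc n)
  have "is_pos j (Br []) q \<longleftrightarrow> j = 0 \<and> q = PInit" for j q
    by (cases q) auto
  with Suc show ?case by (cases p; cases k) (auto)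
qed

lemma iter_src_globe:
  "iter_src (Pos B) k j (globe_pos (k + j) Neg) = globe_pos k Neg"
  by (induction j) (simp_all add: Pos_def src_globe_pos del: globe_pos.simps)

lemma iter_tgt_globe:
  "iter_tgt (Pos B) k (Suc j) (globe_pos (Suc (k + j)) e) = globe_pos k Plus"
  by (induction j arbitrary: e) (simp_all add: Pos_def tgt_globe_pos del: globe_pos.simps)

lemma iota_glob_eq:
  assumes "k < n"
  shows "iota_glob n k e = globe_pos k e"
proof -
  obtain j where n: "n = Suc (k + j)" using assms less_imp_Suc_add by blast
  then have "n - k = Suc j" by simp
  with n iter_src_globe[of "globe n" k "Suc j"] iter_tgt_globe[of "globe n" k j]
  show ?thesis by (cases e) (simp_all add: iota_glob_def globe_top_eq del: iter_src.simps iter_tgt.simps globe_pos.simps)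
qed

lemma sphere_glob_sel [simp]:
  "gcells (sphere_glob n) k = (if k < n then UNIV else {})"
  "gsrc (sphere_glob n) k e = Neg" "gtgt (sphere_glob n) k e = Plus"
  using sgn.exhaust by (auto simp: sphere_glob_def)

lemma globular_sphere_glob: "globular_set (sphere_glob n)"
  by (auto simp: globular_set_def)

lemma omega_hom_iota: "omega_hom (Kw (Sphere_bd n)) (Kw (Disk n)) (Cell_map (iota n))"
proof -
  have "glob_map (sphere_glob n) (Pos (globe n)) (iota_glob n)"
    unfolding glob_map_def
    by (auto simp: Pos_def iota_glob_eq is_pos_globe src_globe_pos tgt_globe_pos
        simp del: globe_pos.simps) (metis sgn.exhaust)
  then have "comp_hom_upto N (Sphere_bd n) (Disk n) (iota n)" for N
    unfolding Sphere_bd_def Disk_def iota_def Free_map_def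
    by (intro comp_hom_upto_Var globular_sphere_glob globular_Pos glob_map_imp_upto)
  then show ?thesis
    by (rule omega_hom_Cell_map) (simp add: Sphere_bd_def is_computad_Free globular_sphere_glob)
qed

text \<open>By freeness, \<open>u\<close> amounts to cells \<open>w k e\<close> of \<open>Y\<close>, one for each cell of \<open>S\<^bsub>n-1\<^esub>\<close>, and \<open>v\<close>
  to the single cell \<open>x\<close> of \<open>X\<close> on the top position of the globe.  A cell \<open>y\<close> over \<open>x\<close> with
  boundary \<open>w\<close> completes the \<open>w k e\<close> to a globular map \<open>g\<close> on the positions of the globe, and
  the lift is its extension.\<close>

lemma has_rlp_if_local_omega_surjection:
  assumes Y: "is_omega_cat Y" and X: "is_omega_cat X" and f: "omega_hom Y X f"
    and surj: "local_omega_surjection Y X f"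
  shows "has_rlp Y X f (Kw (Sphere_bd n)) (Kw (Disk n)) (Cell_map (iota n))"
  unfolding has_rlp_def
proof (intro allI impI)
  fix u v
  assume u: "omega_hom (Kw (Sphere_bd n)) Y u" and v: "omega_hom (Kw (Disk n)) X v"
    and fu: "\<forall>k. \<forall>a\<in>gcells (Kw (Sphere_bd n)) k. f k (u k a) = v k (Cell_map (iota n) k a)"
  have globs: "globular_set Y" "globular_set X"
    using X Y by (simp_all add: is_omega_cat_def)
  have compD: "is_computad (Disk n)" and compS: "is_computad (Sphere_bd n)"
    by (simp_all add: Disk_def Sphere_bd_def is_computad_Free globular_Pos globular_sphere_glob)
  define w where "w k e = u k (Var k e)" for k e
  have S: "Var k e \<in> cells (Sphere_bd n) k" if "k < n" for k e
    using that by (simp add: Sphere_bd_def Var_in_cells)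
  have w_cell: "w k e \<in> gcells Y k" if "k < n" for k e
    using u S[OF that] by (simp add: w_def omega_hom_def glob_map_def)
  have w_glob: "gsrc Y k (w (Suc k) e) = w k Neg \<and> gtgt Y k (w (Suc k) e) = w k Plus"
    if "Suc k < n" for k e
    using omega_hom_Kw_src_tgt[OF u S[OF that]] by (simp add: w_def Sphere_bd_def)
  have f_w: "f k (w k e) = v k (Var k (globe_pos k e))" if "k < n" for k e
    using fu S[OF that] iota_glob_eq[OF that] by (simp add: w_def Cell_map_def iota_def Free_map_def)
  define x where "x = v n (Var n (globe_pos n Neg))"
  have D: "Var n (globe_pos n Neg) \<in> cells (Disk n) n"
    unfolding Disk_def by (rule Var_in_cells) (simp add: Pos_def is_pos_globe)
  then have x: "x \<in> gcells X n"
    using v by (simp add: x_def omega_hom_def glob_map_def)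
  have "\<exists>y\<in>gcells Y n. f n y = x \<and> (\<forall>m. n = Suc m \<longrightarrow> gsrc Y m y = w m Neg \<and> gtgt Y m y = w m Plus)"
  proof (cases n)
    case 0
    then show ?thesis using surj x by (auto simp: local_omega_surjection_def)
  next
    case (Suc m)
    have "gsrc X m x = v m (Var m (globe_pos m Neg)) \<and> gtgt X m x = v m (Var m (globe_pos m Plus))"
      using omega_hom_Kw_src_tgt[OF v] D Suc
      by (simp add: x_def Disk_def Pos_def src_globe_pos tgt_globe_pos
          del: globe_pos.simps globe.simps)
    then have "gsrc X m x = f m (w m Neg) \<and> gtgt X m x = f m (w m Plus)"
      using f_w Suc by simp
    moreover have "\<forall>k. m = Suc k \<longrightarrow> gsrc Y k (w m Neg) = gsrc Y k (w m Plus) \<and>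
        gtgt Y k (w m Neg) = gtgt Y k (w m Plus)"
      using w_glob Suc by auto
    ultimately have "\<exists>y\<in>gcells Y (Suc m). gsrc Y m y = w m Neg \<and> gtgt Y m y = w m Plus \<and> f (Suc m) y = x"
      using surj w_cell[of m] x Suc unfolding local_omega_surjection_def by blast
    then show ?thesis using Suc by auto
  qed
  then obtain y where y: "y \<in> gcells Y n" "f n y = x"
    and y_st: "\<And>m. n = Suc m \<Longrightarrow> gsrc Y m y = w m Neg \<and> gtgt Y m y = w m Plus"
    by blast
  define g where "g k p = (if k = n then y else w k (if p = globe_pos k Neg then Neg else Plus))" for k p
  have g_w: "g k (globe_pos k e) = w k e" if "k < n" for k e
    using that globe_pos_inject by (cases e) (auto simp: g_def)
  have g_glob: "glob_map (Pos (globe n)) Y g"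
    unfolding glob_map_def
  proof (intro conjI allI ballI)
    fix k p
    assume "p \<in> gcells (Pos (globe n)) k"
    then show "g k p \<in> gcells Y k"
      using y w_cell by (auto simp: Pos_def is_pos_globe g_def)
  next
    fix k p
    assume p: "p \<in> gcells (Pos (globe n)) (Suc k)"
    then obtain e where k: "k < n" and pe: "p = globe_pos (Suc k) e"
      by (auto simp: Pos_def is_pos_globe simp del: globe_pos.simps)
    have "gsrc Y k (g (Suc k) p) = w k Neg \<and> gtgt Y k (g (Suc k) p) = w k Plus"
      using k y_st[of k] w_glob[of k] by (auto simp: g_def)
    then show "g k (gsrc (Pos (globe n)) k p) = gsrc Y k (g (Suc k) p)"
      "g k (gtgt (Pos (globe n)) k p) = gtgt Y k (g (Suc k) p)"
      using g_w[OF k] pe by (simp_all add: Pos_def src_globe_pos tgt_globe_pos del: globe_pos.simps)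
  qed
  define l where "l = (\<lambda>k::nat. extend_hom Y g)"
  have l: "omega_hom (Kw (Disk n)) Y l"
    unfolding l_def
    by (rule omega_hom_extend_hom[OF Y compD])
      (use g_glob in \<open>auto simp: Disk_def glob_map_def\<close>)
  have "l k (Cell_map (iota n) k a) = u k a" if "a \<in> gcells (Kw (Sphere_bd n)) k" for k a
  proof (rule omega_hom_Kw_unique[OF compS _ u])
    show "omega_hom (Kw (Sphere_bd n)) Y (\<lambda>k a. l k (Cell_map (iota n) k a))"
      by (intro omega_hom_comp[OF _ omega_hom_iota l] is_omega_cat_Kw compS globular_Kw compD)
    show "l k (Cell_map (iota n) k (Var k e)) = u k (Var k e)" if "e \<in> gens (Sphere_bd n) k" for k e
    proof -
      have "k < n" using that by (simp add: Sphere_bd_def split: if_splits)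
      then show ?thesis
        using g_w by (simp add: l_def Cell_map_def iota_def Free_map_def iota_glob_eq w_def)
    qed
  qed (use that in simp)
  moreover have "f k (l k b) = v k b" if "b \<in> gcells (Kw (Disk n)) k" for k b
  proof (rule omega_hom_Kw_unique[OF compD _ v])
    show "omega_hom (Kw (Disk n)) X (\<lambda>k b. f k (l k b))"
      by (intro omega_hom_comp[OF _ l f] is_omega_cat_Kw compD globs)
    show "f k (l k (Var k p)) = v k (Var k p)" if "p \<in> gens (Disk n) k" for k p
    proof -
      have "is_pos k (globe n) p" using that by (simp add: Disk_def Pos_def)
      then consider e where "k < n" "p = globe_pos k e" | "k = n" "p = globe_pos n Neg"
        by (auto simp: is_pos_globe)
      then show ?thesis
      proof cases
        case 1
        then show ?thesis using g_w f_w by (simp add: l_def)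
      next
        case 2
        then show ?thesis using y by (simp add: l_def g_def x_def)
      qed
    qed
  qed (use that in simp)
  ultimately show "\<exists>l. omega_hom (Kw (Disk n)) Y l \<and>
      (\<forall>k. \<forall>a\<in>gcells (Kw (Sphere_bd n)) k. l k (Cell_map (iota n) k a) = u k a) \<and>
      (\<forall>k. \<forall>b\<in>gcells (Kw (Disk n)) k. f k (l k b) = v k b)"
    using l by blast
qed

theorem mainTheorem3:
  fixes X :: "'a omega_cat"
  assumes "is_omega_cat X"
  shows "is_computad (W_comp X) \<and> is_omega_cat (Kw (W_comp X)) \<and>
         omega_hom (Kw (W_comp X)) X (r_hom X) \<and>
         (\<forall>n. has_rlp (Kw (W_comp X)) X (r_hom X)
                (Kw (Sphere_bd n)) (Kw (Disk n)) (Cell_map (iota n))) \<and>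
         local_omega_surjection (Kw (W_comp X)) X (r_hom X)"
  using assms
  by (simp add: is_computad_W_comp is_omega_cat_Kw omega_hom_r local_omega_surjection_r
      has_rlp_if_local_omega_surjection)

end
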